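(* Consider a time-homogeneous absorbing discrete-time Markov chain on the finite state space $\Omega=\{1,\dots,|\Omega|\}$ with transition matrix $P=\begin{bmatrix} Q & R\\ 0 & I\end{bmatrix}$ in canonical form (transient states first), and impulse-reward matrix $\Theta=\begin{bmatrix}\Theta_1 & \Theta_2\\ 0 & 0\end{bmatrix}$. Let $H=\Theta\odot P=\begin{bmatrix} H_1 & H_2\\ 0&0\end{bmatrix}$ and $N=(I-Q)^{-1}$. For $n\ge 1$ put $$A_n=\sum_{i=0}^{n-1}Q^{i}H_1Q^{n-i-1},\qquad B_n=N(I-Q^{n})H_2+N(I-Q^{n-1})H_1NR-\sum_{i=0}^{n-2}Q^{i}H_1NQ^{n-i-1}R,$$ and let $A_\infty=\lim_{n\to\infty}A_n$ and $B_\infty=\lim_{n\to\infty}B_n$. Let $\hat R_\infty$ be the $|\Omega|\times|\Omega|$ matrix with entries $\hat R_\infty(i,j)=\lim_{n\to\infty}\hat R_n(i,j)$. Then these limits exist, $A_\infty=0$, and $$\hat R_\infty=\begin{bmatrix}0 & B_\infty\\ 0&0\end{bmatrix},\qquad B_\infty=N\,(H_2+H_1NR).$$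
   Context: Let $S_0,S_1,\dots$ be a time-homogeneous Markov chain on a finite state space $\Omega=\{1,\dots,|\Omega|\}$ with transition probabilities $p_{ij}=\Pr(S_n=j\mid S_{n-1}=i)$ and transition matrix $P=(p_{ij})$. A state $i$ is absorbing if $p_{ii}=1$ (so $p_{ij}=0$ for $j\ne i$), and is transient otherwise. The chain is absorbing: there is at least one absorbing state, and from every transient state some absorbing state can be reached in finitely many transitions. Let $\Omega_T$ and $\Omega_A$ be the sets of transient and absorbing states; transient states have lower indices than absorbing states, so $P=\begin{bmatrix} Q & R\\ 0 & I\end{bmatrix}$ with $Q$ of size $|\Omega_T|\times|\Omega_T|$ and $R$ of size $|\Omega_T|\times|\Omega_A|$. The matrix $I-Q$ is invertible and $N=(I-Q)^{-1}$ is called the fundamental matrix. By convention $Q^0=I$ and empty sums are $0$. The impulse-reward matrix $\Theta=(\rho_{ij})$ is a real $|\Omega|\times|\Omega|$ matrix, $\rho_{ij}$ being the reward accumulated on a transition from $i$ to $j$. Transitions out of absorbing states carry zero reward, so $\Theta=\begin{bmatrix}\Theta_1 & \Theta_2\\ 0&0\end{bmatrix}$ with $\Theta_1$ of size $|\Omega_T|\times|\Omega_T|$ and $\Theta_2$ of size $|\Omega_T|\times|\Omega_A|$. $H=\Theta\odot P$ is the entrywise (Hadamard) product, $H(i,j)=\rho_{ij}p_{ij}$, with blocks $H_1,H_2$ partitioned in the same way. The accumulated reward at time $n\ge1$ is the random variable $R_n=\sum_{k=1}^{n}\rho_{S_{k-1}S_k}$ (not to be confused with the matrix $R$). Set $\bar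 R_n(i,j)=\mathbb E(R_n\mid S_0=i,S_n=j)$ and $\hat R_n(i,j)=\bar R_n(i,j)\cdot\Pr(S_n=j\mid S_0=i)$, with $\hat R_n(i,j)=0$ when $\Pr(S_n=j\mid S_0=i)=0$. *)

theory Defs
  imports "HOL-Probability.Probability" "Jordan_Normal_Form.Gauss_Jordan_Elimination"
begin

(* States are numbered from 0, so that they coincide with matrix indices: the state space of a
   chain with transition matrix P is {..<dim_row P}. *)

definition stochastic_mat :: "real mat \<Rightarrow> bool" where
  "stochastic_mat P \<longleftrightarrow> square_mat P \<and>
     (\<forall>i<dim_row P. \<forall>j<dim_col P. 0 \<le> P $$ (i, j)) \<and>
     (\<forall>i<dim_row P. (\<Sum>j<dim_col P. P $$ (i, j)) = 1)"

definition absorbing_states :: "real mat \<Rightarrow> nat set" where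
  "absorbing_states P = {i. i < dim_row P \<and> P $$ (i, i) = 1}"

definition transient_states :: "real mat \<Rightarrow> nat set" where
  "transient_states P = {i. i < dim_row P \<and> P $$ (i, i) \<noteq> 1}"

definition transitions :: "real mat \<Rightarrow> (nat \<times> nat) set" where
  "transitions P = {(i, j). i < dim_row P \<and> j < dim_col P \<and> 0 < P $$ (i, j)}"

definition absorbing_chain :: "real mat \<Rightarrow> bool" where
  "absorbing_chain P \<longleftrightarrow> absorbing_states P \<noteq> {} \<and>
     (\<forall>i\<in>transient_states P. \<exists>j\<in>absorbing_states P. (i, j) \<in> (transitions P)\<^sup>*)"

(* The initial distribution is arbitrary. *)
definition markov_chain :: "'w measure \<Rightarrow> (nat \<Rightarrow> 'w \<Rightarrow> nat) \<Rightarrow> real mat \<Rightarrow> bool" where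
  "markov_chain M S P \<longleftrightarrow> prob_space M \<and> stochastic_mat P \<and>
     (\<forall>n. S n \<in> measurable M (count_space {..<dim_row P})) \<and>
     (\<forall>n x. (\<forall>k\<le>Suc n. x k < dim_row P) \<longrightarrow>
        0 < \<P>(\<omega> in M. \<forall>k\<le>n. S k \<omega> = x k) \<longrightarrow>
        \<P>(\<omega> in M. S (Suc n) \<omega> = x (Suc n) \<bar> \<forall>k\<le>n. S k \<omega> = x k) = P $$ (x n, x (Suc n)))"

definition accumulated_reward :: "real mat \<Rightarrow> (nat \<Rightarrow> 'w \<Rightarrow> nat) \<Rightarrow> nat \<Rightarrow> 'w \<Rightarrow> real" where
  "accumulated_reward \<Theta> S n \<omega> = (\<Sum>k=1..n. \<Theta> $$ (S (k - 1) \<omega>, S k \<omega>))"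

definition cond_expectation_event :: "'w measure \<Rightarrow> ('w \<Rightarrow> real) \<Rightarrow> 'w set \<Rightarrow> real" where
  "cond_expectation_event M X E = (LINT \<omega>:E|M. X \<omega>) / measure M E"

definition R_bar ::
  "'w measure \<Rightarrow> (nat \<Rightarrow> 'w \<Rightarrow> nat) \<Rightarrow> real mat \<Rightarrow> nat \<Rightarrow> nat \<Rightarrow> nat \<Rightarrow> real" where
  "R_bar M S \<Theta> n i j = cond_expectation_event M (accumulated_reward \<Theta> S n)
     {\<omega> \<in> space M. S 0 \<omega> = i \<and> S n \<omega> = j}"

(* Row i is computed under the measure M i, under which state i must be a possible initial state.
   This covers both a single chain whose initial distribution charges every state (M constant)
   and the usual family of laws of the chain started at each state. *)
definition R_hat ::
  "(nat \<Rightarrow> 'w measure) \<Rightarrow> (nat \<Rightarrow> 'w \<Rightarrow> nat) \<Rightarrow> real mat \<Rightarrow> nat \<Rightarrow> real mat" where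
  "R_hat M S \<Theta> n = mat (dim_row \<Theta>) (dim_col \<Theta>) (\<lambda>(i, j).
     if \<P>(\<omega> in M i. S n \<omega> = j \<bar> S 0 \<omega> = i) = 0 then 0
     else R_bar (M i) S \<Theta> n i j * \<P>(\<omega> in M i. S n \<omega> = j \<bar> S 0 \<omega> = i))"

definition hadamard :: "real mat \<Rightarrow> real mat \<Rightarrow> real mat" (infixl "\<odot>" 70) where
  "A \<odot> B = mat (dim_row A) (dim_col A) (\<lambda>ij. A $$ ij * B $$ ij)"

definition mat_sum :: "nat \<Rightarrow> nat \<Rightarrow> (nat \<Rightarrow> real mat) \<Rightarrow> nat set \<Rightarrow> real mat" where
  "mat_sum nr nc F I = mat nr nc (\<lambda>ij. \<Sum>k\<in>I. F k $$ ij)"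

definition mat_tendsto :: "(nat \<Rightarrow> real mat) \<Rightarrow> real mat \<Rightarrow> bool" where
  "mat_tendsto X L \<longleftrightarrow> (\<forall>n. X n \<in> carrier_mat (dim_row L) (dim_col L)) \<and>
     (\<forall>i<dim_row L. \<forall>j<dim_col L. (\<lambda>n. X n $$ (i, j)) \<longlonglongrightarrow> L $$ (i, j))"

definition fundamental_mat :: "real mat \<Rightarrow> real mat" where
  "fundamental_mat Q = the (mat_inverse (1\<^sub>m (dim_row Q) - Q))"

(* Natural-number subtraction is harmless below: every difference is exact when n \<ge> 1, except
   n - 2 for n = 1; the index range 0..n-2 is therefore written {..<n - 1}. *)

definition A_mat :: "real mat \<Rightarrow> real mat \<Rightarrow> nat \<Rightarrow> real mat" where
  "A_mat Q H1 n = mat_sum (dim_row Q) (dim_row Q)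
     (\<lambda>i. Q ^\<^sub>m i * H1 * Q ^\<^sub>m (n - i - 1)) {..<n}"

definition B_mat :: "real mat \<Rightarrow> real mat \<Rightarrow> real mat \<Rightarrow> real mat \<Rightarrow> nat \<Rightarrow> real mat" where
  "B_mat Q R H1 H2 n =
     (let N = fundamental_mat Q; I = 1\<^sub>m (dim_row Q) in
        N * (I - Q ^\<^sub>m n) * H2 + N * (I - Q ^\<^sub>m (n - 1)) * H1 * N * R
        - mat_sum (dim_row Q) (dim_col R)
            (\<lambda>i. Q ^\<^sub>m i * H1 * N * Q ^\<^sub>m (n - i - 1) * R) {..<n - 1})"

end

theory Submission
  imports Defs
begin

text \<open>
  Summing over trajectories, the Markov property gives the recursion
  \<open>R_hat (n + 1) = R_hat n * P + P^n * (\<Theta> \<odot> P)\<close>. In blocks it says that the transient block of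
  \<open>R_hat n\<close> is \<open>A_n\<close>, and that the absorbing block is the partial sum of \<open>A_k * R + Q^k * H2\<close> over
  \<open>k < n\<close>. Since an absorbing state is reachable from everywhere, the powers of the nonnegative matrix
  \<open>Q\<close> are entrywise summable with sum \<open>N\<close>. As \<open>A_(n+1)\<close> is the \<open>n\<close>-th term of the Cauchy product of
  \<open>\<Sum> Q^k\<close>, \<open>H1\<close> and \<open>\<Sum> Q^k\<close>, the series of the \<open>A_n\<close> has sum \<open>N * H1 * N\<close>. Hence \<open>A_n\<close> tends to
  \<open>0\<close>, and the partial sums tend to \<open>N * H1 * N * R + N * H2\<close>. The sum subtracted in \<open>B_n\<close> is a
  convolution of the same kind, with \<open>H1 * N\<close> in place of \<open>H1\<close>, and therefore vanishes in the limit.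
\<close>

subsection \<open>Limits and series of matrices\<close>

lemma mat_sum_carrier [simp]: "mat_sum nr nc F I \<in> carrier_mat nr nc"
  by (simp add: mat_sum_def)

lemma index_mat_sum [simp]:
  "i < nr \<Longrightarrow> j < nc \<Longrightarrow> mat_sum nr nc F I $$ (i, j) = (\<Sum>k\<in>I. F k $$ (i, j))"
  "dim_row (mat_sum nr nc F I) = nr" "dim_col (mat_sum nr nc F I) = nc"
  by (simp_all add: mat_sum_def)

lemma mat_sum_lessThan_Suc:
  assumes "F n \<in> carrier_mat nr nc"
  shows "mat_sum nr nc F {..<Suc n} = mat_sum nr nc F {..<n} + F n"
  by (rule eq_matI) (use assms in auto)

lemma index_mult_mat_sum:
  assumes "A \<in> carrier_mat m p" "B \<in> carrier_mat p q" "i < m" "j < q"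
  shows "(A * B) $$ (i, j) = (\<Sum>k<p. A $$ (i, k) * B $$ (k, j))"
  using assms by (auto simp: scalar_prod_def lessThan_atLeast0 intro!: sum.cong)

lemma mat_sum_mult_right:
  assumes F: "\<And>k. k \<in> I \<Longrightarrow> F k \<in> carrier_mat nr p" and C: "C \<in> carrier_mat p nc"
  shows "mat_sum nr p F I * C = mat_sum nr nc (\<lambda>k. F k * C) I"
proof (rule eq_matI)
  fix i j assume "i < dim_row (mat_sum nr nc (\<lambda>k. F k * C) I)"
    "j < dim_col (mat_sum nr nc (\<lambda>k. F k * C) I)"
  then have ij: "i < nr" "j < nc" by auto
  have "(mat_sum nr p F I * C) $$ (i, j) = (\<Sum>l<p. (\<Sum>k\<in>I. F k $$ (i, l)) * C $$ (l, j))"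
    using ij by (subst index_mult_mat_sum[OF mat_sum_carrier C]) auto
  also have "\<dots> = (\<Sum>k\<in>I. \<Sum>l<p. F k $$ (i, l) * C $$ (l, j))"
    by (simp only: sum_distrib_right, rule sum.swap)
  also have "\<dots> = mat_sum nr nc (\<lambda>k. F k * C) I $$ (i, j)"
    using ij F C by (auto simp: index_mult_mat_sum[OF F C] simp del: index_mult_mat intro!: sum.cong)
  finally show "(mat_sum nr p F I * C) $$ (i, j) = mat_sum nr nc (\<lambda>k. F k * C) I $$ (i, j)" .
qed (use C in auto)

lemma add_diff_cancel_right_mat:
  fixes A B :: "'a::ab_group_add mat"
  assumes "A \<in> carrier_mat m p" "B \<in> carrier_mat m p"
  shows "A + B - B = A"
  by (rule eq_matI) (use assms in auto)

lemma mat_tendsto_const: "mat_tendsto (\<lambda>n. C) C"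
  by (auto simp: mat_tendsto_def)

lemma mat_tendsto_add:
  assumes "mat_tendsto X L" "mat_tendsto Y K" "dim_row K = dim_row L" "dim_col K = dim_col L"
  shows "mat_tendsto (\<lambda>n. X n + Y n) (L + K)"
proof -
  have c: "X n \<in> carrier_mat (dim_row L) (dim_col L)" "Y n \<in> carrier_mat (dim_row L) (dim_col L)" for n
    using assms by (simp_all add: mat_tendsto_def)
  have "(\<lambda>n. X n $$ (i, j) + Y n $$ (i, j)) \<longlonglongrightarrow> (L $$ (i, j) + K $$ (i, j))"
    if "i < dim_row L" "j < dim_col L" for i j
    using assms that by (intro tendsto_add) (simp_all add: mat_tendsto_def)
  then show ?thesis
    using c assms(3,4) carrier_matD[OF c(2)] minus_carrier_mat[OF c(2)] by (simp add: mat_tendsto_def)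
qed

lemma mat_tendsto_diff:
  assumes "mat_tendsto X L" "mat_tendsto Y K" "dim_row K = dim_row L" "dim_col K = dim_col L"
  shows "mat_tendsto (\<lambda>n. X n - Y n) (L - K)"
proof -
  have c: "X n \<in> carrier_mat (dim_row L) (dim_col L)" "Y n \<in> carrier_mat (dim_row L) (dim_col L)" for n
    using assms by (simp_all add: mat_tendsto_def)
  have "(\<lambda>n. X n $$ (i, j) - Y n $$ (i, j)) \<longlonglongrightarrow> (L $$ (i, j) - K $$ (i, j))"
    if "i < dim_row L" "j < dim_col L" for i j
    using assms that by (intro tendsto_diff) (simp_all add: mat_tendsto_def)
  then show ?thesis
    using c assms(3,4) carrier_matD[OF c(2)] minus_carrier_mat[OF c(2)] by (simp add: mat_tendsto_def)
qed

lemma mat_tendsto_mult: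
  assumes X: "mat_tendsto X L" and Y: "mat_tendsto Y K" and LK: "dim_col L = dim_row K"
  shows "mat_tendsto (\<lambda>n. X n * Y n) (L * K)"
proof -
  have c: "X n \<in> carrier_mat (dim_row L) (dim_row K)" "Y n \<in> carrier_mat (dim_row K) (dim_col K)" for n
    using X Y LK by (auto simp: mat_tendsto_def)
  have L: "L \<in> carrier_mat (dim_row L) (dim_row K)" and K: "K \<in> carrier_mat (dim_row K) (dim_col K)"
    using LK by auto
  have "(\<lambda>n. (X n * Y n) $$ (i, j)) \<longlonglongrightarrow> (L * K) $$ (i, j)"
    if "i < dim_row L" "j < dim_col K" for i j
    unfolding index_mult_mat_sum[OF c that] index_mult_mat_sum[OF L K that]
    by (intro tendsto_sum tendsto_mult) (use X Y LK that in \<open>auto simp: mat_tendsto_def\<close>)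
  then show ?thesis
    using mult_carrier_mat[OF c] by (simp add: mat_tendsto_def del: index_mult_mat(1))
qed

text \<open>\<open>mat_tendsto\<close> prescribes the dimensions at every index, so the term dropped
  by the shift needs a hypothesis of its own.\<close>

lemma mat_tendsto_Suc_iff:
  assumes "X 0 \<in> carrier_mat (dim_row L) (dim_col L)"
  shows "mat_tendsto (\<lambda>n. X (Suc n)) L \<longleftrightarrow> mat_tendsto X L"
  using assms filterlim_sequentially_Suc[of "\<lambda>n. X n $$ _"]
  unfolding mat_tendsto_def by (metis not0_implies_Suc)

lemma mat_tendsto_four_block:
  assumes "mat_tendsto X1 L1" "mat_tendsto X2 L2" "mat_tendsto X3 L3" "mat_tendsto X4 L4"
    and L: "L1 \<in> carrier_mat m p" "L2 \<in> carrier_mat m q" "L3 \<in> carrier_mat r p" "L4 \<in> carrier_mat r q"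
  shows "mat_tendsto (\<lambda>n. four_block_mat (X1 n) (X2 n) (X3 n) (X4 n)) (four_block_mat L1 L2 L3 L4)"
proof -
  have X: "X1 n \<in> carrier_mat m p" "X2 n \<in> carrier_mat m q" "X3 n \<in> carrier_mat r p"
    "X4 n \<in> carrier_mat r q" for n
    using assms by (auto simp: mat_tendsto_def)
  have "(\<lambda>n. four_block_mat (X1 n) (X2 n) (X3 n) (X4 n) $$ (i, j)) \<longlonglongrightarrow> four_block_mat L1 L2 L3 L4 $$ (i, j)"
    if ij: "i < m + r" "j < p + q" for i j
    using assms ij X[THEN carrier_matD(1)] X[THEN carrier_matD(2)]
    by (cases "i < m"; cases "j < p") (simp_all add: mat_tendsto_def)
  then show ?thesis
    using X L by (auto simp: mat_tendsto_def)
qed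

section \<open>Entrywise convergent series of matrices\<close>

definition mat_sums :: "(nat \<Rightarrow> real mat) \<Rightarrow> real mat \<Rightarrow> bool" where
  "mat_sums X L \<longleftrightarrow> (\<forall>n. X n \<in> carrier_mat (dim_row L) (dim_col L)) \<and>
     (\<forall>i<dim_row L. \<forall>j<dim_col L. (\<lambda>n. X n $$ (i, j)) sums (L $$ (i, j)))"

text \<open>The dimensions of a single term already fix those of the sum; the entries then agree by
  uniqueness of real sums.\<close>

lemma mat_sums_unique:
  assumes "mat_sums X L" "mat_sums X K"
  shows "L = K"
proof -
  have "X 0 \<in> carrier_mat (dim_row L) (dim_col L)" "X 0 \<in> carrier_mat (dim_row K) (dim_col K)"
    using assms by (auto simp: mat_sums_def)
  then have "dim_row L = dim_row K" "dim_col L = dim_col K" by auto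
  moreover have "L $$ (i, j) = K $$ (i, j)" if "i < dim_row K" "j < dim_col K" for i j
    using assms that calculation by (intro sums_unique2[of "\<lambda>n. X n $$ (i, j)"]) (auto simp: mat_sums_def)
  ultimately show ?thesis
    by (intro eq_matI)
qed

lemma mat_sums_imp_tendsto_zero:
  assumes "mat_sums X L" "L \<in> carrier_mat m p"
  shows "mat_tendsto X (0\<^sub>m m p)"
proof -
  have "(\<lambda>n. X n $$ (i, j)) \<longlonglongrightarrow> 0" if "i < m" "j < p" for i j
    using assms that by (intro summable_LIMSEQ_zero sums_summable[of _ "L $$ (i, j)"]) (auto simp: mat_sums_def)
  then show ?thesis
    using assms by (auto simp: mat_tendsto_def mat_sums_def)
qed

lemma mat_sums_imp_tendsto_partial_sums:
  assumes "mat_sums X L" "L \<in> carrier_mat m p"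
  shows "mat_tendsto (\<lambda>n. mat_sum m p X {..<n}) L"
  using assms unfolding mat_tendsto_def mat_sums_def by (auto simp: sums_def)

lemma mat_sums_add:
  assumes "mat_sums X L" "mat_sums Y K" "dim_row K = dim_row L" "dim_col K = dim_col L"
  shows "mat_sums (\<lambda>n. X n + Y n) (L + K)"
proof -
  have c: "X n \<in> carrier_mat (dim_row L) (dim_col L)" "Y n \<in> carrier_mat (dim_row L) (dim_col L)" for n
    using assms by (simp_all add: mat_sums_def)
  have "(\<lambda>n. X n $$ (i, j) + Y n $$ (i, j)) sums (L $$ (i, j) + K $$ (i, j))"
    if "i < dim_row L" "j < dim_col L" for i j
    using assms that by (intro sums_add) (simp_all add: mat_sums_def)
  then show ?thesis
    using c assms(3,4) carrier_matD[OF c(2)] by (simp add: mat_sums_def)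
qed

lemma mat_sums_mult_right:
  assumes X: "mat_sums X L" and C: "dim_col L = dim_row C"
  shows "mat_sums (\<lambda>n. X n * C) (L * C)"
proof -
  have c: "X n \<in> carrier_mat (dim_row L) (dim_row C)" "L \<in> carrier_mat (dim_row L) (dim_row C)"
    "C \<in> carrier_mat (dim_row C) (dim_col C)" for n
    using X C by (auto simp: mat_sums_def)
  have "(\<lambda>n. (X n * C) $$ (i, j)) sums ((L * C) $$ (i, j))"
    if "i < dim_row L" "j < dim_col C" for i j
    unfolding index_mult_mat_sum[OF c(1,3) that] index_mult_mat_sum[OF c(2,3) that]
    by (intro sums_sum sums_mult2) (use X C that in \<open>auto simp: mat_sums_def\<close>)
  then show ?thesis
    using mult_carrier_mat[OF c(1,3)] by (simp add: mat_sums_def del: index_mult_mat(1))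
qed

lemma mat_sums_mult_left:
  assumes X: "mat_sums X L" and C: "dim_col C = dim_row L"
  shows "mat_sums (\<lambda>n. C * X n) (C * L)"
proof -
  have c: "X n \<in> carrier_mat (dim_col C) (dim_col L)" "L \<in> carrier_mat (dim_col C) (dim_col L)"
    "C \<in> carrier_mat (dim_row C) (dim_col C)" for n
    using X C by (auto simp: mat_sums_def)
  have "(\<lambda>n. (C * X n) $$ (i, j)) sums ((C * L) $$ (i, j))"
    if "i < dim_row C" "j < dim_col L" for i j
    unfolding index_mult_mat_sum[OF c(3,1) that] index_mult_mat_sum[OF c(3,2) that]
    by (intro sums_sum sums_mult) (use X C that in \<open>auto simp: mat_sums_def\<close>)
  then show ?thesis
    using mult_carrier_mat[OF c(3,1)] by (simp add: mat_sums_def del: index_mult_mat(1))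
qed

text \<open>Each entry of a triple product is a finite combination of products of one entry of
  \<open>X\<close> and one of \<open>Y\<close>, with the entries of \<open>C\<close> as constant
  coefficients. This reduces the claim to scalar Cauchy products. Nonnegativity supplies the
  absolute convergence these require, while \<open>C\<close> may have any sign, as rewards
  do.\<close>

lemma mat_sums_Cauchy_product:
  assumes X: "mat_sums X L" and Y: "mat_sums Y K"
    and L: "L \<in> carrier_mat m p" and C: "C \<in> carrier_mat p q" and K: "K \<in> carrier_mat q r"
    and X_nonneg: "\<And>n i j. i < m \<Longrightarrow> j < p \<Longrightarrow> 0 \<le> X n $$ (i, j)"
    and Y_nonneg: "\<And>n i j. i < q \<Longrightarrow> j < r \<Longrightarrow> 0 \<le> Y n $$ (i, j)"
  shows "mat_sums (\<lambda>n. mat_sum m r (\<lambda>k. X k * C * Y (n - k)) {..n}) (L * C * K)"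
proof -
  have Xc: "X n \<in> carrier_mat m p" and Yc: "Y n \<in> carrier_mat q r" for n
    using X Y L K by (auto simp: mat_sums_def)
  have triple: "(A * C * B) $$ (i, j) =
      (\<Sum>v<q. \<Sum>u<p. C $$ (u, v) * (A $$ (i, u) * B $$ (v, j)))"
    if A: "A \<in> carrier_mat m p" and B: "B \<in> carrier_mat q r" and ij: "i < m" "j < r" for A B i j
    using ij by (simp add: index_mult_mat_sum[OF mult_carrier_mat[OF A C] B]
        index_mult_mat_sum[OF A C] sum_distrib_left sum_distrib_right mult_ac del: index_mult_mat)
  have "(\<lambda>n. \<Sum>k\<le>n. (X k * C * Y (n - k)) $$ (i, j)) sums ((L * C * K) $$ (i, j))"
    if ij: "i < m" "j < r" for i j
  proof -
    have sX: "(\<lambda>n. X n $$ (i, u)) sums (L $$ (i, u))" if "u < p" for u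
      using X L ij that by (auto simp: mat_sums_def)
    have sY: "(\<lambda>n. Y n $$ (v, j)) sums (K $$ (v, j))" if "v < q" for v
      using Y K ij that by (auto simp: mat_sums_def)
    have conv: "(\<lambda>n. \<Sum>k\<le>n. X k $$ (i, u) * Y (n - k) $$ (v, j)) sums (L $$ (i, u) * K $$ (v, j))"
      if "u < p" "v < q" for u v
      using Cauchy_product_sums[of "\<lambda>n. X n $$ (i, u)" "\<lambda>n. Y n $$ (v, j)"]
        sX[OF that(1)] sY[OF that(2)] X_nonneg[OF ij(1) that(1)] Y_nonneg[OF that(2) ij(2)]
      by (simp add: sums_iff)
    have "(\<Sum>k\<le>n. (X k * C * Y (n - k)) $$ (i, j)) = (\<Sum>v<q. \<Sum>u<p. C $$ (u, v) *
        (\<Sum>k\<le>n. X k $$ (i, u) * Y (n - k) $$ (v, j)))" for n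
    proof -
      have "(\<Sum>k\<le>n. (X k * C * Y (n - k)) $$ (i, j)) = (\<Sum>k\<le>n. \<Sum>v<q. \<Sum>u<p. C $$ (u, v) *
          (X k $$ (i, u) * Y (n - k) $$ (v, j)))"
        by (simp only: triple[OF Xc Yc ij])
      also have "\<dots> = (\<Sum>v<q. \<Sum>k\<le>n. \<Sum>u<p. C $$ (u, v) *
          (X k $$ (i, u) * Y (n - k) $$ (v, j)))"
        by (rule sum.swap)
      also have "\<dots> = (\<Sum>v<q. \<Sum>u<p. \<Sum>k\<le>n. C $$ (u, v) *
          (X k $$ (i, u) * Y (n - k) $$ (v, j)))"
        by (rule sum.cong[OF refl], rule sum.swap)
      finally show ?thesis by (simp only: sum_distrib_left)
    qed
    then show ?thesis
      unfolding triple[OF L K ij] by (auto intro!: sums_sum sums_mult conv)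
  qed
  then show ?thesis
    using L K by (auto simp: mat_sums_def)
qed

text \<open>The recursion of \<open>pow_mat\<close> adds the new factor on the right; first-step
  arguments need it on the left.\<close>

lemma pow_mat_Suc_left:
  fixes Q :: "'a::semiring_1 mat"
  assumes "Q \<in> carrier_mat t t"
  shows "Q ^\<^sub>m Suc n = Q * Q ^\<^sub>m n"
proof (induction n)
  case 0
  then show ?case using assms by simp
next
  case (Suc n)
  have "Q ^\<^sub>m Suc (Suc n) = (Q * Q ^\<^sub>m n) * Q" using Suc by simp
  also have "\<dots> = Q * (Q ^\<^sub>m n * Q)" using assms by (intro assoc_mult_mat) auto
  finally show ?case by simp
qed

text \<open>The shifted series of powers has the sum \<open>L - 1\<^sub>m t\<close> (drop the zeroth
  term), but also \<open>L * Q\<close> and \<open>Q * L\<close> (factor out \<open>Q\<close>).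
  Equating them shows that \<open>L\<close> is a two-sided inverse, so invertibility is obtained
  rather than assumed.\<close>

lemma fundamental_mat_eq_Neumann_series:
  assumes Q: "Q \<in> carrier_mat t t" and L: "L \<in> carrier_mat t t"
    and sums: "mat_sums (\<lambda>n. Q ^\<^sub>m n) L"
  shows "fundamental_mat Q = L"
proof -
  have "mat_sums (\<lambda>n. Q ^\<^sub>m Suc n) (L - 1\<^sub>m t)"
    unfolding mat_sums_def
  proof (intro conjI allI impI)
    fix i j assume "i < dim_row (L - 1\<^sub>m t)" "j < dim_col (L - 1\<^sub>m t)"
    then have ij: "i < t" "j < t" by auto
    then have "(\<lambda>n. (Q ^\<^sub>m n) $$ (i, j)) sums (L $$ (i, j))"
      using sums L by (auto simp: mat_sums_def)
    then have "(\<lambda>n. (Q ^\<^sub>m Suc n) $$ (i, j)) sums (L $$ (i, j) - (Q ^\<^sub>m 0) $$ (i, j))"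
      by (subst sums_Suc_iff) simp
    then show "(\<lambda>n. (Q ^\<^sub>m Suc n) $$ (i, j)) sums ((L - 1\<^sub>m t) $$ (i, j))"
      using ij Q L by simp
  qed (use Q in auto)
  moreover have "mat_sums (\<lambda>n. Q ^\<^sub>m Suc n) (L * Q)"
    using mat_sums_mult_right[OF sums, of Q] Q L by simp
  moreover have "mat_sums (\<lambda>n. Q ^\<^sub>m Suc n) (Q * L)"
    unfolding pow_mat_Suc_left[OF Q] using mat_sums_mult_left[OF sums, of Q] Q L by simp
  ultimately have LQ: "L * Q = L - 1\<^sub>m t" and QL: "Q * L = L - 1\<^sub>m t"
    by (blast intro: mat_sums_unique)+
  let ?I = "1\<^sub>m t :: real mat"
  have cancel: "L - (L - ?I) = ?I" using L by (intro eq_matI) auto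
  have inv: "L * (?I - Q) = ?I" "(?I - Q) * L = ?I"
    using mult_minus_distrib_mat[OF L one_carrier_mat Q] minus_mult_distrib_mat[OF one_carrier_mat Q L]
      L LQ QL cancel by auto
  have IQ: "?I - Q \<in> carrier_mat t t" using Q by auto
  \<comment> \<open>\<open>fundamental_mat\<close> applies \<open>the\<close> to the result of
    \<open>mat_inverse\<close>; being a unit excludes the result \<open>None\<close>.\<close>
  then have "?I - Q \<in> Units (ring_mat TYPE(real) t ())"
    unfolding Units_def ring_mat_simps using inv L by (auto intro!: exI[of _ L] bexI[of _ L])
  then obtain N where N: "mat_inverse (?I - Q) = Some N"
    using mat_inverse(1)[OF IQ, of "()"] by (cases "mat_inverse (?I - Q)") auto
  from mat_inverse(2)[OF IQ this] have "N * (?I - Q) = ?I" "N \<in> carrier_mat t t" by auto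
  then have "N = N * ((?I - Q) * L)" using inv by simp
  also have "\<dots> = (N * (?I - Q)) * L"
    using assoc_mult_mat[OF \<open>N \<in> carrier_mat t t\<close> IQ L] by simp
  also have "\<dots> = L" using \<open>N * (?I - Q) = ?I\<close> L by simp
  finally show ?thesis using N Q by (simp add: fundamental_mat_def)
qed

subsection \<open>Expected rewards along trajectories\<close>

locale markov_chain_on =
  fixes M :: "'w measure" and S :: "nat \<Rightarrow> 'w \<Rightarrow> nat" and P :: "real mat"
  assumes markov_chain: "markov_chain M S P"
begin

sublocale prob_space M
  using markov_chain by (simp add: markov_chain_def)

abbreviation "m \<equiv> dim_row P"

lemma dim_col_P [simp]: "dim_col P = m"
  using markov_chain by (simp add: markov_chain_def stochastic_mat_def)

lemma measurable_S [measurable]: "S n \<in> measurable M (count_space UNIV)"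
  using markov_chain measurable_compose[of "S n" M "count_space {..<m}" "\<lambda>x. x" "count_space UNIV"]
  by (auto simp: markov_chain_def)

lemma S_less: "\<omega> \<in> space M \<Longrightarrow> S n \<omega> < m"
  using markov_chain measurable_space[of "S n" M] by (fastforce simp: markov_chain_def)

text \<open>Restricting to times up to \<open>n\<close> makes the trajectory a random variable with
  values in the finite set \<open>trajectories n\<close>, so that expectations become finite
  sums.\<close>

definition trajectory :: "nat \<Rightarrow> 'w \<Rightarrow> nat \<Rightarrow> nat" where
  "trajectory n \<omega> = restrict (\<lambda>k. S k \<omega>) {..n}"

abbreviation trajectories :: "nat \<Rightarrow> (nat \<Rightarrow> nat) set" where
  "trajectories n \<equiv> PiE {..n} (\<lambda>_. {..<m})"

lemma trajectory_eq_iff: "x \<in> trajectories n \<Longrightarrow> trajectory n \<omega> = x \<longleftrightarrow> (\<forall>k\<le>n. S k \<omega> = x k)"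
  by (auto simp: trajectory_def fun_eq_iff PiE_iff extensional_def)

text \<open>The Markov property in product form. \<open>markov_chain\<close> says nothing about
  histories of probability zero, but for these both sides vanish.\<close>

lemma prob_step:
  assumes x: "x \<in> trajectories n" and j: "j < m"
  shows "\<P>(\<omega> in M. trajectory n \<omega> = x \<and> S (Suc n) \<omega> = j) = \<P>(\<omega> in M. trajectory n \<omega> = x) * P $$ (x n, j)"
proof (cases "\<P>(\<omega> in M. trajectory n \<omega> = x) = 0")
  case True
  have "\<P>(\<omega> in M. trajectory n \<omega> = x \<and> S (Suc n) \<omega> = j) \<le> \<P>(\<omega> in M. trajectory n \<omega> = x)"
    unfolding trajectory_eq_iff[OF x] by (rule finite_measure_mono) auto
  with True show ?thesis by (simp add: measure_le_0_iff)
next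
  case False
  \<comment> \<open>The Markov property is stated for one path that contains the target state as
    well, hence the history is extended by \<open>j\<close>.\<close>
  define y where "y = x(Suc n := j)"
  have y: "\<forall>k\<le>Suc n. y k < m" "y n = x n" "y (Suc n) = j" "\<And>\<omega>. (\<forall>k\<le>n. S k \<omega> = y k) \<longleftrightarrow> trajectory n \<omega> = x"
    using x j by (auto simp: y_def trajectory_eq_iff PiE_iff le_Suc_eq)
  have "0 < \<P>(\<omega> in M. \<forall>k\<le>n. S k \<omega> = y k)"
    using False by (simp add: y(4) zero_less_measure_iff)
  then have "\<P>(\<omega> in M. S (Suc n) \<omega> = y (Suc n) \<bar> \<forall>k\<le>n. S k \<omega> = y k) = P $$ (y n, y (Suc n))"
    using markov_chain y(1) by (simp add: markov_chain_def)
  then have "\<P>(\<omega> in M. S (Suc n) \<omega> = j \<bar> trajectory n \<omega> = x) = P $$ (x n, j)"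
    unfolding y .
  with False show ?thesis
    by (simp add: cond_prob_def field_simps conj_commute)
qed

text \<open>The integrand is a finite linear combination of indicators, one for each trajectory. The
  event \<open>A\<close> is separate because it may concern time \<open>n + 1\<close>, which the
  trajectory up to \<open>n\<close> does not determine.\<close>

lemma
  fixes g :: "(nat \<Rightarrow> nat) \<Rightarrow> real"
  assumes [measurable]: "Measurable.pred M A"
  shows integrable_trajectory: "integrable M (\<lambda>\<omega>. g (trajectory n \<omega>) * of_bool (A \<omega>))"
    and expectation_trajectory: "expectation (\<lambda>\<omega>. g (trajectory n \<omega>) * of_bool (A \<omega>)) =
      (\<Sum>x\<in>trajectories n. g x * \<P>(\<omega> in M. trajectory n \<omega> = x \<and> A \<omega>))"
proof -
  define E where "E x = {\<omega> \<in> space M. trajectory n \<omega> = x \<and> A \<omega>}" for x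
  have E: "E x \<in> events" if "x \<in> trajectories n" for x
    unfolding E_def trajectory_eq_iff[OF that] by measurable
  have fin: "finite (trajectories n)" by (intro finite_PiE) auto
  have eq: "g (trajectory n \<omega>) * of_bool (A \<omega>) = (\<Sum>x\<in>trajectories n. g x * indicator (E x) \<omega>)"
    if "\<omega> \<in> space M" for \<omega>
  proof -
    have "trajectory n \<omega> \<in> trajectories n" using S_less[OF that] by (auto simp: trajectory_def)
    then have "(\<Sum>x\<in>trajectories n. g x * indicator (E x) \<omega>) =
        (\<Sum>x\<in>{trajectory n \<omega>}. g x * indicator (E x) \<omega>)"
      using fin by (intro sum.mono_neutral_right) (auto simp: E_def)
    then show ?thesis using that by (simp add: E_def indicator_def)
  qed
  have int: "integrable M (\<lambda>\<omega>. g x * indicator (E x) \<omega>)" if "x \<in> trajectories n" for x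
    using E[OF that] by (simp add: integrable_real_indicator emeasure_eq_measure)
  show "integrable M (\<lambda>\<omega>. g (trajectory n \<omega>) * of_bool (A \<omega>))"
    by (subst Bochner_Integration.integrable_cong[OF refl eq]) (auto intro: int)
  have "expectation (\<lambda>\<omega>. g (trajectory n \<omega>) * of_bool (A \<omega>)) =
      expectation (\<lambda>\<omega>. \<Sum>x\<in>trajectories n. g x * indicator (E x) \<omega>)"
    by (rule Bochner_Integration.integral_cong[OF refl eq])
  also have "\<dots> = (\<Sum>x\<in>trajectories n. g x * prob (E x))"
    using E int by (subst Bochner_Integration.integral_sum)
      (auto intro!: sum.cong simp: Int_absorb1 sets.sets_into_space)
  finally show "expectation (\<lambda>\<omega>. g (trajectory n \<omega>) * of_bool (A \<omega>)) =
      (\<Sum>x\<in>trajectories n. g x * \<P>(\<omega> in M. trajectory n \<omega> = x \<and> A \<omega>))"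
    by (simp add: E_def)
qed

text \<open>A Chapman-Kolmogorov identity weighted by an arbitrary function \<open>g\<close> of the
  past: \<open>prob_step\<close> is applied to each trajectory, and the trajectories are grouped by
  their state \<open>v\<close> at time \<open>n\<close>. Suitable choices of \<open>g\<close> yield
  both recursions below.\<close>

lemma expectation_trajectory_step:
  fixes g :: "(nat \<Rightarrow> nat) \<Rightarrow> real"
  assumes "j < m"
  shows "expectation (\<lambda>\<omega>. g (trajectory n \<omega>) * of_bool (S (Suc n) \<omega> = j)) =
    (\<Sum>v<m. expectation (\<lambda>\<omega>. g (trajectory n \<omega>) * of_bool (S n \<omega> = v)) * P $$ (v, j))"
proof -
  have "(\<Sum>v<m. expectation (\<lambda>\<omega>. g (trajectory n \<omega>) * of_bool (S n \<omega> = v)) * P $$ (v, j)) =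
      (\<Sum>v<m. \<Sum>x\<in>trajectories n. g x * \<P>(\<omega> in M. trajectory n \<omega> = x) * (of_bool (x n = v) * P $$ (v, j)))"
  proof (intro sum.cong refl)
    fix v
    have "expectation (\<lambda>\<omega>. g (trajectory n \<omega>) * of_bool (S n \<omega> = v)) =
        (\<Sum>x\<in>trajectories n. g x * \<P>(\<omega> in M. trajectory n \<omega> = x \<and> S n \<omega> = v))"
      by (rule expectation_trajectory) measurable
    also have "\<dots> = (\<Sum>x\<in>trajectories n. g x * \<P>(\<omega> in M. trajectory n \<omega> = x) * of_bool (x n = v))"
    proof (intro sum.cong refl)
      fix x
      have "{\<omega> \<in> space M. trajectory n \<omega> = x \<and> S n \<omega> = v} =
          (if x n = v then {\<omega> \<in> space M. trajectory n \<omega> = x} else {})"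
        by (auto simp: trajectory_def)
      then show "g x * \<P>(\<omega> in M. trajectory n \<omega> = x \<and> S n \<omega> = v) =
          g x * \<P>(\<omega> in M. trajectory n \<omega> = x) * of_bool (x n = v)"
        by simp
    qed
    finally show "expectation (\<lambda>\<omega>. g (trajectory n \<omega>) * of_bool (S n \<omega> = v)) * P $$ (v, j) =
        (\<Sum>x\<in>trajectories n. g x * \<P>(\<omega> in M. trajectory n \<omega> = x) * (of_bool (x n = v) * P $$ (v, j)))"
      by (simp add: sum_distrib_left mult_ac)
  qed
  also have "\<dots> = (\<Sum>x\<in>trajectories n. g x * \<P>(\<omega> in M. trajectory n \<omega> = x) *
      (\<Sum>v<m. of_bool (x n = v) * P $$ (v, j)))"
    unfolding sum_distrib_left by (rule sum.swap)
  also have "\<dots> = (\<Sum>x\<in>trajectories n. g x * \<P>(\<omega> in M. trajectory n \<omega> = x \<and> S (Suc n) \<omega> = j))"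
  proof (intro sum.cong refl)
    fix x assume x: "x \<in> trajectories n"
    then have "x n < m" by auto
    then have "(\<Sum>v<m. of_bool (x n = v) * P $$ (v, j)) = P $$ (x n, j)"
      by (simp add: of_bool_def if_distrib[of "\<lambda>c. c * _"] cong: if_cong)
    then show "g x * \<P>(\<omega> in M. trajectory n \<omega> = x) * (\<Sum>v<m. of_bool (x n = v) * P $$ (v, j)) =
        g x * \<P>(\<omega> in M. trajectory n \<omega> = x \<and> S (Suc n) \<omega> = j)"
      using prob_step[OF x assms] by simp
  qed
  also have "\<dots> = expectation (\<lambda>\<omega>. g (trajectory n \<omega>) * of_bool (S (Suc n) \<omega> = j))"
    by (rule expectation_trajectory[symmetric]) measurable
  finally show ?thesis by simp
qed

section \<open>Probabilities and rewards between two fixed endpoints\<close>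

definition joint :: "nat \<Rightarrow> nat \<Rightarrow> nat \<Rightarrow> real" where
  "joint n i j = \<P>(\<omega> in M. S 0 \<omega> = i \<and> S n \<omega> = j)"

text \<open>The numerator of \<open>R_bar\<close>. Without the division the recursion in
  \<open>n\<close> is linear and endpoints of probability zero are no special case.\<close>

definition joint_reward :: "real mat \<Rightarrow> nat \<Rightarrow> nat \<Rightarrow> nat \<Rightarrow> real" where
  "joint_reward \<Theta> n i j =
     (LINT \<omega>:{\<omega> \<in> space M. S 0 \<omega> = i \<and> S n \<omega> = j}|M. accumulated_reward \<Theta> S n \<omega>)"

definition path_reward :: "real mat \<Rightarrow> nat \<Rightarrow> (nat \<Rightarrow> nat) \<Rightarrow> real" where
  "path_reward \<Theta> n x = (\<Sum>k=1..n. \<Theta> $$ (x (k - 1), x k))"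

lemma accumulated_reward_eq: "accumulated_reward \<Theta> S n \<omega> = path_reward \<Theta> n (trajectory n \<omega>)"
  by (auto simp: accumulated_reward_def path_reward_def trajectory_def intro!: sum.cong)

lemma trajectory_0 [simp]: "trajectory n \<omega> 0 = S 0 \<omega>" and trajectory_n [simp]: "trajectory n \<omega> n = S n \<omega>"
  by (auto simp: trajectory_def)

lemma joint_eq: "joint n i j =
    expectation (\<lambda>\<omega>. of_bool (trajectory n \<omega> 0 = i) * of_bool (S n \<omega> = j))"
proof -
  have "joint n i j = expectation (indicator {\<omega> \<in> space M. S 0 \<omega> = i \<and> S n \<omega> = j})"
    unfolding joint_def by (subst Bochner_Integration.integral_indicator) (auto intro!: arg_cong[where f=prob])
  also have "\<dots> = expectation (\<lambda>\<omega>. of_bool (trajectory n \<omega> 0 = i) * of_bool (S n \<omega> = j))"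
    by (intro Bochner_Integration.integral_cong) (auto simp: indicator_def)
  finally show ?thesis .
qed

lemma joint_reward_eq: "joint_reward \<Theta> n i j =
    expectation (\<lambda>\<omega>. (path_reward \<Theta> n (trajectory n \<omega>) * of_bool (trajectory n \<omega> 0 = i)) * of_bool (S n \<omega> = j))"
  unfolding joint_reward_def set_lebesgue_integral_def accumulated_reward_eq
  by (intro Bochner_Integration.integral_cong) (auto simp: indicator_def)

lemma joint_Suc:
  assumes "j < m"
  shows "joint (Suc n) i j = (\<Sum>v<m. joint n i v * P $$ (v, j))"
proof -
  have "joint (Suc n) i j = expectation (\<lambda>\<omega>. of_bool (trajectory n \<omega> 0 = i) * of_bool (S (Suc n) \<omega> = j))"
    by (simp add: joint_eq)
  also have "\<dots> = (\<Sum>v<m. joint n i v * P $$ (v, j))"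
    using expectation_trajectory_step[OF assms, of "\<lambda>x. of_bool (x 0 = i)" n] by (simp add: joint_eq)
  finally show ?thesis .
qed

text \<open>Once the state at time \<open>n + 1\<close> is fixed to be \<open>j\<close>, the reward
  of the last transition depends only on the state at time \<open>n\<close>. The whole reward is
  then a function of the trajectory up to \<open>n\<close>, and
  \<open>expectation_trajectory_step\<close> applies.\<close>

lemma joint_reward_Suc:
  assumes "j < m"
  shows "joint_reward \<Theta> (Suc n) i j =
    (\<Sum>v<m. joint_reward \<Theta> n i v * P $$ (v, j) + joint n i v * (\<Theta> $$ (v, j) * P $$ (v, j)))"
proof -
  \<comment> \<open>The reward up to time \<open>n + 1\<close> on paths from \<open>i\<close>, with
    the last state replaced by its known value \<open>j\<close>.\<close>
  define g where "g x = (path_reward \<Theta> n x + \<Theta> $$ (x n, j)) * of_bool (x 0 = i)" for x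
  have "joint_reward \<Theta> (Suc n) i j = expectation (\<lambda>\<omega>. g (trajectory n \<omega>) * of_bool (S (Suc n) \<omega> = j))"
    unfolding joint_reward_eq g_def
    by (intro Bochner_Integration.integral_cong refl)
      (auto simp: accumulated_reward_eq[symmetric], auto simp: accumulated_reward_def)
  also have "\<dots> = (\<Sum>v<m. expectation (\<lambda>\<omega>. g (trajectory n \<omega>) * of_bool (S n \<omega> = v)) * P $$ (v, j))"
    by (rule expectation_trajectory_step[OF assms])
  also have "\<dots> = (\<Sum>v<m. (joint_reward \<Theta> n i v + \<Theta> $$ (v, j) * joint n i v) * P $$ (v, j))"
  proof (intro sum.cong refl arg_cong2[where f="(*)"])
    fix v
    have "expectation (\<lambda>\<omega>. g (trajectory n \<omega>) * of_bool (S n \<omega> = v)) =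

      expectation (\<lambda>\<omega>. (path_reward \<Theta> n (trajectory n \<omega>) * of_bool (trajectory n \<omega> 0 = i)) * of_bool (S n \<omega> = v) +
        \<Theta> $$ (v, j) * (of_bool (trajectory n \<omega> 0 = i) * of_bool (S n \<omega> = v)))"
      by (intro Bochner_Integration.integral_cong refl) (auto simp: g_def)
    also have "\<dots> = joint_reward \<Theta> n i v + \<Theta> $$ (v, j) * joint n i v"
      unfolding joint_reward_eq joint_eq
      using integrable_trajectory[of "\<lambda>\<omega>. S n \<omega> = v" "\<lambda>x. path_reward \<Theta> n x * of_bool (x 0 = i)" n]
        integrable_trajectory[of "\<lambda>\<omega>. S n \<omega> = v" "\<lambda>x. of_bool (x 0 = i)" n]
      by (subst Bochner_Integration.integral_add) auto
    finally show "expectation (\<lambda>\<omega>. g (trajectory n \<omega>) * of_bool (S n \<omega> = v)) =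
      joint_reward \<Theta> n i v + \<Theta> $$ (v, j) * joint n i v" .
  qed
  finally show ?thesis by (simp add: algebra_simps)
qed

text \<open>Identifies the weights of the last-transition rewards in
  \<open>joint_reward_Suc\<close>, up to the initial probability, as entries of a power of
  \<open>P\<close>.\<close>

lemma joint_pow:
  assumes "i < m" "j < m"
  shows "joint n i j = \<P>(\<omega> in M. S 0 \<omega> = i) * (P ^\<^sub>m n) $$ (i, j)"
  using assms(2)
proof (induction n arbitrary: j)
  case 0
  have "{\<omega> \<in> space M. S 0 \<omega> = i \<and> S 0 \<omega> = j} = (if i = j then {\<omega> \<in> space M. S 0 \<omega> = i} else {})"
    by auto
  then show ?case using assms 0 by (simp add: joint_def)
next
  case (Suc n)
  have P: "P \<in> carrier_mat m m" by auto
  have "joint (Suc n) i j =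
      (\<Sum>v<m. \<P>(\<omega> in M. S 0 \<omega> = i) * ((P ^\<^sub>m n) $$ (i, v) * P $$ (v, j)))"
    unfolding joint_Suc[OF Suc.prems] by (intro sum.cong refl) (simp add: Suc.IH)
  also have "\<dots> = \<P>(\<omega> in M. S 0 \<omega> = i) * (P ^\<^sub>m Suc n) $$ (i, j)"
    unfolding pow_mat.simps index_mult_mat_sum[OF pow_carrier_mat[OF P] P assms(1) Suc.prems]
    by (simp only: sum_distrib_left)
  finally show ?case .
qed

end

text \<open>Conditioning on both endpoints and then multiplying by the probability of the second given the
  first leaves only the division by the probability of the initial state.\<close>

lemma index_R_hat:
  assumes "markov_chain (M i) S P" and pos: "0 < \<P>(\<omega> in M i. S 0 \<omega> = i)"
    and ij: "i < dim_row \<Theta>" "j < dim_col \<Theta>"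
  shows "R_hat M S \<Theta> n $$ (i, j) =
    markov_chain_on.joint_reward (M i) S \<Theta> n i j / \<P>(\<omega> in M i. S 0 \<omega> = i)"
proof -
  interpret markov_chain_on "M i" S P by standard fact
  have cond: "\<P>(\<omega> in M i. S n \<omega> = j \<bar> S 0 \<omega> = i) = joint n i j / \<P>(\<omega> in M i. S 0 \<omega> = i)"
    by (simp add: cond_prob_def joint_def conj_commute)
  let ?E = "{\<omega> \<in> space (M i). S 0 \<omega> = i \<and> S n \<omega> = j}"
  \<comment> \<open>In this case \<open>R_hat\<close> is 0 by its default. The integral over a null
    event is 0 as well, so one formula covers both cases.\<close>
  have "joint_reward \<Theta> n i j = 0" if "joint n i j = 0"
  proof -
    have "?E \<in> null_sets (M i)"
      using that by (auto simp: joint_def null_sets_def emeasure_eq_measure)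
    then have "AE \<omega> in M i. indicator ?E \<omega> *\<^sub>R accumulated_reward \<Theta> S n \<omega> = 0"
      by (rule eventually_mono[OF AE_not_in]) simp
    then show ?thesis
      unfolding joint_reward_def set_lebesgue_integral_def by (rule integral_eq_zero_AE)
  qed
  then show ?thesis
    using ij pos unfolding R_hat_def
    by (auto simp: cond R_bar_def cond_expectation_event_def joint_reward_def joint_def)
qed

section \<open>The matrix recursion for the rewards\<close>

lemma R_hat_0: "R_hat M S \<Theta> 0 = 0\<^sub>m (dim_row \<Theta>) (dim_col \<Theta>)"
  by (rule eq_matI)
    (auto simp: R_hat_def R_bar_def cond_expectation_event_def accumulated_reward_def set_lebesgue_integral_def)

lemma R_hat_Suc:
  assumes chain: "\<And>i. i < m \<Longrightarrow> markov_chain (M i) S P"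
    and pos: "\<And>i. i < m \<Longrightarrow> 0 < \<P>(\<omega> in M i. S 0 \<omega> = i)"
    and P: "P \<in> carrier_mat m m" and \<Theta>: "\<Theta> \<in> carrier_mat m m"
  shows "R_hat M S \<Theta> (Suc n) = R_hat M S \<Theta> n * P + P ^\<^sub>m n * (\<Theta> \<odot> P)"
proof (rule eq_matI)
  have R: "R_hat M S \<Theta> n \<in> carrier_mat m m" for n using \<Theta> by (auto simp: R_hat_def)
  have H: "\<Theta> \<odot> P \<in> carrier_mat m m" using \<Theta> by (auto simp: hadamard_def)
  fix i j assume "i < dim_row (R_hat M S \<Theta> n * P + P ^\<^sub>m n * (\<Theta> \<odot> P))"
    "j < dim_col (R_hat M S \<Theta> n * P + P ^\<^sub>m n * (\<Theta> \<odot> P))"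
  then have ij: "i < m" "j < m" using P H by auto
  \<comment> \<open>The measure changes with the row, so the chain is interpreted only after
    \<open>i\<close> is fixed. The recursion stays within that row, and dividing by the initial
    probability is harmless because it does not depend on \<open>n\<close>.\<close>
  interpret markov_chain_on "M i" S P by standard (rule chain[OF ij(1)])
  have idx: "R_hat M S \<Theta> n $$ (i, j) = joint_reward \<Theta> n i j / \<P>(\<omega> in M i. S 0 \<omega> = i)"
    if "j < m" for j n
    using index_R_hat[of M i S P] chain pos ij that \<Theta> by auto
  have dim: "dim_row P = m" using P by auto
  have Pn: "joint n i v = \<P>(\<omega> in M i. S 0 \<omega> = i) * (P ^\<^sub>m n) $$ (i, v)" if "v < m" for v
    using joint_pow[of i v n] ij that dim by simp
  have "R_hat M S \<Theta> (Suc n) $$ (i, j) =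
      (\<Sum>v<m. R_hat M S \<Theta> n $$ (i, v) * P $$ (v, j) + (P ^\<^sub>m n) $$ (i, v) * (\<Theta> $$ (v, j) * P $$ (v, j)))"
    using joint_reward_Suc[of j \<Theta> n i] ij pos[OF ij(1)]
    by (simp add: idx dim Pn sum_divide_distrib add_divide_distrib)
  also have "\<dots> = (R_hat M S \<Theta> n * P + P ^\<^sub>m n * (\<Theta> \<odot> P)) $$ (i, j)"
    using ij P H \<Theta> by (simp add: index_mult_mat_sum[OF R P] index_mult_mat_sum[OF pow_carrier_mat[OF P] H]
        sum.distrib del: index_mult_mat(1)) (simp add: hadamard_def)
  finally show "R_hat M S \<Theta> (Suc n) $$ (i, j) = (R_hat M S \<Theta> n * P + P ^\<^sub>m n * (\<Theta> \<odot> P)) $$ (i, j)" .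
qed (use P \<Theta> in \<open>auto simp: R_hat_def hadamard_def\<close>)

subsection \<open>Powers of the transient block\<close>

locale substochastic_mat =
  fixes Q :: "real mat" and t :: nat
  assumes carrier: "Q \<in> carrier_mat t t"
    and nonneg: "\<And>i j. i < t \<Longrightarrow> j < t \<Longrightarrow> 0 \<le> Q $$ (i, j)"
    and row_sum_le_1: "\<And>i. i < t \<Longrightarrow> (\<Sum>j<t. Q $$ (i, j)) \<le> 1"
begin

text \<open>When \<open>Q\<close> is the transient block of a chain, this is the probability that the chain started
  at \<open>i\<close> has not been absorbed after \<open>n\<close> steps.\<close>

definition survival :: "nat \<Rightarrow> nat \<Rightarrow> real" where
  "survival n i = (\<Sum>j<t. (Q ^\<^sub>m n) $$ (i, j))"

lemma pow_Suc_index: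
  "i < t \<Longrightarrow> j < t \<Longrightarrow> (Q ^\<^sub>m Suc n) $$ (i, j) = (\<Sum>k<t. Q $$ (i, k) * (Q ^\<^sub>m n) $$ (k, j))"
  unfolding pow_mat_Suc_left[OF carrier]
  by (rule index_mult_mat_sum[OF carrier pow_carrier_mat[OF carrier]])

lemma pow_nonneg: "i < t \<Longrightarrow> j < t \<Longrightarrow> 0 \<le> (Q ^\<^sub>m n) $$ (i, j)"
proof (induction n arbitrary: i)
  case 0
  then show ?case using carrier by auto
next
  case (Suc n)
  then show ?case
    unfolding pow_Suc_index[OF Suc.prems] by (intro sum_nonneg mult_nonneg_nonneg nonneg) auto
qed

lemma survival_0: "i < t \<Longrightarrow> survival 0 i = 1"
  using carrier by (simp add: survival_def)

lemma survival_Suc: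
  assumes "i < t"
  shows "survival (Suc n) i = (\<Sum>k<t. Q $$ (i, k) * survival n k)"
proof -
  have "survival (Suc n) i = (\<Sum>j<t. \<Sum>k<t. Q $$ (i, k) * (Q ^\<^sub>m n) $$ (k, j))"
    unfolding survival_def using assms by (intro sum.cong refl pow_Suc_index) auto
  also have "\<dots> = (\<Sum>k<t. \<Sum>j<t. Q $$ (i, k) * (Q ^\<^sub>m n) $$ (k, j))"
    by (rule sum.swap)
  finally show ?thesis by (simp add: survival_def sum_distrib_left)
qed

lemma survival_nonneg: "i < t \<Longrightarrow> 0 \<le> survival n i"
  unfolding survival_def by (intro sum_nonneg pow_nonneg) auto

text \<open>With \<open>c = 1\<close> this gives monotonicity in time, with \<open>c < 1\<close> a
  geometric contraction over blocks of \<open>k\<close> steps.\<close>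

lemma survival_add_le:
  assumes c: "\<And>l. l < t \<Longrightarrow> survival k l \<le> c" and "i < t"
  shows "survival (n + k) i \<le> c * survival n i"
  using \<open>i < t\<close>
proof (induction n arbitrary: i)
  case 0
  then show ?case using c by (simp add: survival_0)
next
  case (Suc n)
  have "survival (Suc n + k) i = (\<Sum>j<t. Q $$ (i, j) * survival (n + k) j)"
    using survival_Suc[OF Suc.prems] by simp
  also have "\<dots> \<le> (\<Sum>j<t. Q $$ (i, j) * (c * survival n j))"
    using Suc by (intro sum_mono mult_left_mono nonneg) auto
  also have "\<dots> = c * survival (Suc n) i"
    by (simp add: survival_Suc[OF Suc.prems] sum_distrib_left mult_ac)
  finally show ?case .
qed

lemma survival_le_1: "i < t \<Longrightarrow> survival n i \<le> 1"
proof (induction n arbitrary: i)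
  case (Suc n)
  have "survival (Suc n) i \<le> (\<Sum>k<t. Q $$ (i, k) * 1)"
    unfolding survival_Suc[OF Suc.prems] using Suc by (intro sum_mono mult_left_mono nonneg) auto
  then show ?case using row_sum_le_1[OF Suc.prems] by simp
qed (simp add: survival_0)

lemma survival_mono: "i < t \<Longrightarrow> survival (n + k) i \<le> survival n i"
  using survival_add_le[of k 1 i n] survival_le_1 by simp

text \<open>Each state may leak at a time of its own. The sum \<open>K\<close> of these times bounds
  them all, so by monotonicity every state has leaked by time \<open>K\<close>; finiteness then
  gives a uniform factor \<open>c < 1\<close>.\<close>

lemma summable_survival:
  assumes leak: "\<And>i. i < t \<Longrightarrow> \<exists>n. survival n i < 1" and i: "i < t"
  shows "summable (\<lambda>n. survival n i)"
proof -
  obtain f where f: "\<And>i. i < t \<Longrightarrow> survival (f i) i < 1" using leak by metis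
  define K where "K = (\<Sum>i<t. f i)"
  define c where "c = Max ((\<lambda>l. survival K l) ` {..<t})"
  have less: "survival K l < 1" if "l < t" for l
  proof -
    have "f l \<le> K" unfolding K_def using that by (intro member_le_sum) auto
    then show ?thesis
      using survival_mono[OF that, of "f l" "K - f l"] f[OF that] by simp
  qed
  have c: "survival K l \<le> c" if "l < t" for l
    unfolding c_def using that by (intro Max_ge) auto
  have "c < 1"
    unfolding c_def using i less by (subst Max_less_iff) auto
  \<comment> \<open>Every block of \<open>K\<close> steps shrinks the survival probability by the factor \<open>c < 1\<close>, so a partial
    sum \<open>s\<close> satisfies \<open>s \<le> K + c * s\<close>.\<close>
  show ?thesis
  proof (rule summableI_nonneg_bounded)
    fix n
    have split: "(\<Sum>k<K + n. survival k i) = (\<Sum>k<K. survival k i) + (\<Sum>k<n. survival (k + K) i)"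
      by (induction n) (simp_all add: add_ac)
    have "(\<Sum>k<n. survival k i) \<le> (\<Sum>k<K + n. survival k i)"
      using survival_nonneg[OF i] by (intro sum_mono2) auto
    also have "\<dots> \<le> (\<Sum>k<K. 1) + (\<Sum>k<n. c * survival k i)"
      unfolding split using i by (intro add_mono sum_mono survival_le_1 survival_add_le c)
    finally show "(\<Sum>k<n. survival k i) \<le> K / (1 - c)"
      using \<open>c < 1\<close> by (simp add: sum_distrib_left[symmetric] field_simps)
  qed (rule survival_nonneg[OF i])
qed

lemma mat_sums_pow:
  assumes leak: "\<And>i. i < t \<Longrightarrow> \<exists>n. survival n i < 1"
  obtains L where "L \<in> carrier_mat t t" "mat_sums (\<lambda>n. Q ^\<^sub>m n) L"
proof
  let ?L = "mat t t (\<lambda>ij. \<Sum>n. (Q ^\<^sub>m n) $$ ij)"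
  have "summable (\<lambda>n. (Q ^\<^sub>m n) $$ (i, j))" if ij: "i < t" "j < t" for i j
  proof (rule summable_comparison_test'[OF summable_survival[OF leak ij(1)]])
    fix n
    have "(Q ^\<^sub>m n) $$ (i, j) \<le> survival n i"
      unfolding survival_def using ij by (intro member_le_sum pow_nonneg) auto
    then show "norm ((Q ^\<^sub>m n) $$ (i, j)) \<le> survival n i"
      using pow_nonneg[OF ij] by simp
  qed
  then show "mat_sums (\<lambda>n. Q ^\<^sub>m n) ?L"
    using carrier by (auto simp: mat_sums_def summable_sums)
qed auto

end

text \<open>Reachability is turned into leakage by following a path to an absorbing state backwards.
  A step out of the transient block makes the row sum of \<open>Q\<close> smaller than 1. A step to
  a transient state that leaks by time \<open>n\<close> passes the deficit on to time
  \<open>n + 1\<close>, since all survival probabilities are at most 1.\<close>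

lemma absorbing_chain_mat_sums_pow:
  assumes Q: "Q \<in> carrier_mat t t" and R: "R \<in> carrier_mat t a"
    and P: "P = four_block_mat Q R (0\<^sub>m a t) (1\<^sub>m a)"
    and transient: "transient_states P = {..<t}" and absorbing: "absorbing_states P = {t..<t + a}"
    and chain: "absorbing_chain P" and stochastic: "stochastic_mat P"
  obtains L where "L \<in> carrier_mat t t" "mat_sums (\<lambda>n. Q ^\<^sub>m n) L"
    "\<And>n i j. i < t \<Longrightarrow> j < t \<Longrightarrow> 0 \<le> (Q ^\<^sub>m n) $$ (i, j)"
proof -
  have dim: "dim_row P = t + a" "dim_col P = t + a" using P Q R by auto
  have P_Q: "P $$ (i, j) = Q $$ (i, j)" if "i < t" "j < t" for i j
    using that P Q R by auto
  have P_nonneg: "0 \<le> P $$ (i, j)" if "i < t + a" "j < t + a" for i j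
    using stochastic that dim by (auto simp: stochastic_mat_def)
  have row_split: "(\<Sum>j<t. Q $$ (i, j)) + (\<Sum>j\<in>{t..<t + a}. P $$ (i, j)) = 1" if "i < t" for i
  proof -
    have "(\<Sum>j<t + a. P $$ (i, j)) = (\<Sum>j<t. P $$ (i, j)) + (\<Sum>j\<in>{t..<t + a}. P $$ (i, j))"
      by (simp add: lessThan_atLeast0 sum.atLeastLessThan_concat)
    then show ?thesis
      using stochastic that dim P_Q by (simp add: stochastic_mat_def)
  qed
  interpret substochastic_mat Q t
  proof
    fix i assume i: "i < t"
    have "0 \<le> (\<Sum>j\<in>{t..<t + a}. P $$ (i, j))"
      using i by (intro sum_nonneg P_nonneg) auto
    then show "(\<Sum>j<t. Q $$ (i, j)) \<le> 1" using row_split[OF i] by simp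
  qed (use Q P_nonneg P_Q in \<open>auto simp flip: P_Q\<close>)
  \<comment> \<open>The premise \<open>i < t\<close> belongs to the induction claim, which makes it
    vacuous at the absorbing end of the path.\<close>
  have "i < t \<longrightarrow> (\<exists>n. survival n i < 1)" if "(i, j) \<in> (transitions P)\<^sup>*" "j \<in> absorbing_states P" for i j
    using that(1)
  proof (induction rule: converse_rtrancl_induct)
    case base
    then show ?case using that(2) absorbing by auto
  next
    case (step y z)
    show ?case
    proof
      assume y: "y < t"
      have z: "z < t + a" "0 < P $$ (y, z)" using step(1) dim by (auto simp: transitions_def)
      show "\<exists>n. survival n y < 1"
      proof (cases "z < t")
        case True
        then obtain n where n: "survival n z < 1" using step by blast
        have "survival (Suc n) y < (\<Sum>k<t. Q $$ (y, k) * 1)"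
          unfolding survival_Suc[OF y]
        proof (rule sum_strict_mono_ex1)
          show "\<forall>k\<in>{..<t}. Q $$ (y, k) * survival n k \<le> Q $$ (y, k) * 1"
            using y by (intro ballI mult_left_mono survival_le_1 nonneg) auto
          show "\<exists>k\<in>{..<t}. Q $$ (y, k) * survival n k < Q $$ (y, k) * 1"
            using True n z P_Q[OF y True] by (intro bexI[of _ z]) auto
        qed simp
        then have "survival (Suc n) y < 1" using row_sum_le_1[OF y] by simp
        then show ?thesis by blast
      next
        case False
        have "0 < (\<Sum>j\<in>{t..<t + a}. P $$ (y, j))"
          using False z y by (intro sum_pos2[of _ z] P_nonneg) auto
        then have "survival (Suc 0) y < 1"
          using row_split[OF y] by (simp add: survival_Suc[OF y] survival_0)
        then show ?thesis by blast
      qed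
    qed
  qed
  then have "\<exists>n. survival n i < 1" if "i < t" for i
    using that chain transient unfolding absorbing_chain_def by blast
  then show ?thesis
    using mat_sums_pow pow_nonneg that by metis
qed

subsection \<open>Block form of the reward matrix\<close>

lemma A_mat_carrier: "Q \<in> carrier_mat t t \<Longrightarrow> A_mat Q C n \<in> carrier_mat t t"
  by (simp add: A_mat_def)

lemma A_mat_0: "Q \<in> carrier_mat t t \<Longrightarrow> A_mat Q C 0 = 0\<^sub>m t t"
  by (rule eq_matI) (auto simp: A_mat_def)

text \<open>Multiplying by \<open>Q\<close> raises every right-hand exponent by one, and the new
  summand has right-hand exponent 0. The transient block of \<open>R_hat\<close> obeys the same
  recursion.\<close>

lemma A_mat_Suc:
  assumes Q: "Q \<in> carrier_mat t t" and C: "C \<in> carrier_mat t t"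
  shows "A_mat Q C (Suc n) = A_mat Q C n * Q + Q ^\<^sub>m n * C"
proof -
  have c: "Q ^\<^sub>m i * C * Q ^\<^sub>m k \<in> carrier_mat t t" for i k
    using Q C by auto
  have "A_mat Q C n * Q = mat_sum t t (\<lambda>i. Q ^\<^sub>m i * C * Q ^\<^sub>m (n - i - 1) * Q) {..<n}"
    using Q unfolding A_mat_def by (simp add: mat_sum_mult_right[OF c Q])
  also have "\<dots> = mat_sum t t (\<lambda>i. Q ^\<^sub>m i * C * Q ^\<^sub>m (n - i)) {..<n}"
    unfolding mat_sum_def
  proof (intro cong_mat refl sum.cong, goal_cases)
    case (1 i j k)
    \<comment> \<open>Here \<open>k < n\<close>, so the truncated subtraction is exact.\<close>
    then have "Q ^\<^sub>m (n - k) = Q ^\<^sub>m (n - k - 1) * Q"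
      by (metis lessThan_iff pow_mat.simps(2) Suc_diff_Suc diff_Suc_eq_diff_pred diff_commute)
    then show ?case
      using assoc_mult_mat[OF mult_carrier_mat[OF pow_carrier_mat[OF Q] C] pow_carrier_mat[OF Q] Q]
      by simp
  qed
  finally have "A_mat Q C n * Q = mat_sum t t (\<lambda>i. Q ^\<^sub>m i * C * Q ^\<^sub>m (n - i)) {..<n}" .
  moreover have "A_mat Q C (Suc n) =
      mat_sum t t (\<lambda>i. Q ^\<^sub>m i * C * Q ^\<^sub>m (n - i)) {..<n} + Q ^\<^sub>m n * C * Q ^\<^sub>m (n - n)"
    using Q by (simp add: A_mat_def mat_sum_lessThan_Suc[OF c] del: diff_self_eq_0)
  moreover have "Q ^\<^sub>m n * C * Q ^\<^sub>m (n - n) = Q ^\<^sub>m n * C"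
    using Q C by (simp add: right_mult_one_mat[OF mult_carrier_mat[OF pow_carrier_mat[OF Q] C]])
  ultimately show ?thesis by simp
qed

text \<open>\<open>C\<close> is kept general: \<open>H1\<close> serves the rewards,
  \<open>H1 * N\<close> the sum subtracted in \<open>B_mat\<close>. The Cauchy product starts at
  \<open>A_mat Q C 1\<close>; the zero matrix at index 0 does not change the sum.\<close>

lemma mat_sums_A_mat:
  assumes Q: "Q \<in> carrier_mat t t" and C: "C \<in> carrier_mat t t" and N: "N \<in> carrier_mat t t"
    and sums: "mat_sums (\<lambda>n. Q ^\<^sub>m n) N"
    and nonneg: "\<And>n i j. i < t \<Longrightarrow> j < t \<Longrightarrow> 0 \<le> (Q ^\<^sub>m n) $$ (i, j)"
  shows "mat_sums (A_mat Q C) (N * C * N)"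
proof -
  have "A_mat Q C (Suc n) = mat_sum t t (\<lambda>k. Q ^\<^sub>m k * C * Q ^\<^sub>m (n - k)) {..n}" for n
    using Q by (simp add: A_mat_def lessThan_Suc_atMost)
  then have S: "mat_sums (\<lambda>n. A_mat Q C (Suc n)) (N * C * N)"
    using mat_sums_Cauchy_product[OF sums sums N C N nonneg nonneg] by simp
  have "(\<lambda>n. A_mat Q C n $$ (i, j)) sums ((N * C * N) $$ (i, j))" if ij: "i < t" "j < t" for i j
  proof -
    have "(\<lambda>n. A_mat Q C (Suc n) $$ (i, j)) sums ((N * C * N) $$ (i, j))"
      using S ij N unfolding mat_sums_def by auto
    then show ?thesis
      using sums_Suc ij by (fastforce simp: A_mat_0[OF Q])
  qed
  then show ?thesis
    using N A_mat_carrier[OF Q] by (auto simp: mat_sums_def simp del: index_mult_mat(1))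
qed

text \<open>The block \<open>X\<close> can stay unspecified: in the recursion it only meets the zero
  rows of \<open>\<Theta> \<odot> P\<close>.\<close>

lemma pow_four_block_absorbing:
  assumes Q: "Q \<in> carrier_mat t t" and R: "R \<in> carrier_mat t a"
  obtains X where "X \<in> carrier_mat t a"
    "four_block_mat Q R (0\<^sub>m a t) (1\<^sub>m a) ^\<^sub>m n = four_block_mat (Q ^\<^sub>m n) X (0\<^sub>m a t) (1\<^sub>m a)"
proof (induction n arbitrary: thesis)
  case 0
  show ?case using 0[of "0\<^sub>m t a"] Q by simp
next
  case (Suc n)
  obtain X where X: "X \<in> carrier_mat t a"
    "four_block_mat Q R (0\<^sub>m a t) (1\<^sub>m a) ^\<^sub>m n = four_block_mat (Q ^\<^sub>m n) X (0\<^sub>m a t) (1\<^sub>m a)"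
    using Suc.IH by blast
  have "four_block_mat Q R (0\<^sub>m a t) (1\<^sub>m a) ^\<^sub>m Suc n =
      four_block_mat (Q ^\<^sub>m Suc n) (Q ^\<^sub>m n * R + X) (0\<^sub>m a t) (1\<^sub>m a)"
    unfolding pow_mat.simps X(2)
      mult_four_block_mat[OF pow_carrier_mat[OF Q] X(1) zero_carrier_mat one_carrier_mat
        Q R zero_carrier_mat one_carrier_mat]
    using Q R X(1) by (intro cong_four_block_mat) auto
  with Suc.prems[of "Q ^\<^sub>m n * R + X"] X(1) show ?case by auto
qed

text \<open>The identity block of \<open>P\<close> carries the old absorbing block over unchanged at
  each step, so this block accumulates as a partial sum, while the transient block follows
  \<open>A_mat_Suc\<close>.\<close>

lemma R_hat_blocks:
  assumes Q: "Q \<in> carrier_mat t t" and R: "R \<in> carrier_mat t a"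
    and P: "P = four_block_mat Q R (0\<^sub>m a t) (1\<^sub>m a)"
    and chain: "\<And>i. i < t + a \<Longrightarrow> markov_chain (M i) S P"
    and pos: "\<And>i. i < t + a \<Longrightarrow> 0 < \<P>(\<omega> in M i. S 0 \<omega> = i)"
    and \<Theta>: "\<Theta> \<in> carrier_mat (t + a) (t + a)"
    and H1: "H1 \<in> carrier_mat t t" and H2: "H2 \<in> carrier_mat t a"
    and H: "\<Theta> \<odot> P = four_block_mat H1 H2 (0\<^sub>m a t) (0\<^sub>m a a)"
  shows "R_hat M S \<Theta> n = four_block_mat (A_mat Q H1 n)
    (mat_sum t a (\<lambda>k. A_mat Q H1 k * R + Q ^\<^sub>m k * H2) {..<n}) (0\<^sub>m a t) (0\<^sub>m a a)"
proof (induction n)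
  case 0
  have "mat_sum t a F {..<0} = 0\<^sub>m t a" for F
    by (rule eq_matI) auto
  then show ?case
    using \<Theta> by (simp add: R_hat_0 A_mat_0[OF Q] del: lessThan_0)
next
  case (Suc n)
  let ?U = "\<lambda>k. A_mat Q H1 k * R + Q ^\<^sub>m k * H2"
  let ?B = "mat_sum t a ?U {..<n}"
  note A = A_mat_carrier[OF Q, of H1 n] and Qn = pow_carrier_mat[OF Q, of n]
  have U: "?U n \<in> carrier_mat t a" using A R Qn H2 by auto
  have Pc: "P \<in> carrier_mat (t + a) (t + a)" using P Q by auto
  obtain X where X: "X \<in> carrier_mat t a" "P ^\<^sub>m n = four_block_mat (Q ^\<^sub>m n) X (0\<^sub>m a t) (1\<^sub>m a)"
    using pow_four_block_absorbing[OF Q R, of n] P by metis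
  have "R_hat M S \<Theta> n * P =
      four_block_mat (A_mat Q H1 n * Q) (A_mat Q H1 n * R + ?B) (0\<^sub>m a t) (0\<^sub>m a a)"
    unfolding Suc P
      mult_four_block_mat[OF A mat_sum_carrier zero_carrier_mat zero_carrier_mat
        Q R zero_carrier_mat one_carrier_mat]
    using A Q R by (intro cong_four_block_mat) auto
  moreover have "P ^\<^sub>m n * (\<Theta> \<odot> P) =
      four_block_mat (Q ^\<^sub>m n * H1) (Q ^\<^sub>m n * H2) (0\<^sub>m a t) (0\<^sub>m a a)"
    unfolding X(2) H
      mult_four_block_mat[OF Qn X(1) zero_carrier_mat one_carrier_mat
        H1 H2 zero_carrier_mat zero_carrier_mat]
    using Qn H1 H2 X(1) by (intro cong_four_block_mat) auto
  moreover have "R_hat M S \<Theta> (Suc n) = R_hat M S \<Theta> n * P + P ^\<^sub>m n * (\<Theta> \<odot> P)"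
    by (rule R_hat_Suc[OF chain pos Pc \<Theta>])
  moreover have "A_mat Q H1 n * Q \<in> carrier_mat t t" "A_mat Q H1 n * R + ?B \<in> carrier_mat t a"
    "Q ^\<^sub>m n * H1 \<in> carrier_mat t t" "Q ^\<^sub>m n * H2 \<in> carrier_mat t a"
    using A Q R Qn H1 H2 by auto
  ultimately have "R_hat M S \<Theta> (Suc n) = four_block_mat (A_mat Q H1 n * Q + Q ^\<^sub>m n * H1)
      ((A_mat Q H1 n * R + ?B) + Q ^\<^sub>m n * H2) (0\<^sub>m a t + 0\<^sub>m a t) (0\<^sub>m a a + 0\<^sub>m a a)"
    by (simp only: add_four_block_mat[of _ t t _ a _ a] zero_carrier_mat)
  moreover have "(A_mat Q H1 n * R + ?B) + Q ^\<^sub>m n * H2 = mat_sum t a ?U {..<Suc n}"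
    unfolding mat_sum_lessThan_Suc[of ?U, OF U]
    using A R Qn H2 by (intro eq_matI) (auto simp del: index_mult_mat(1))
  ultimately show ?case
    by (simp add: A_mat_Suc[OF Q H1])
qed

text \<open>At \<open>Suc n\<close> the truncated \<open>n - 1\<close> disappears. The sum
  subtracted in \<open>B_mat\<close> stops one summand before that of \<open>A_mat\<close> with
  \<open>H1 * N\<close>, which is why the last summand is taken off again.\<close>

lemma B_mat_Suc:
  assumes Q: "Q \<in> carrier_mat t t" and R: "R \<in> carrier_mat t a" and H1: "H1 \<in> carrier_mat t t"
    and N: "fundamental_mat Q = N" "N \<in> carrier_mat t t"
  shows "B_mat Q R H1 H2 (Suc n) =
    N * (1\<^sub>m t - Q ^\<^sub>m Suc n) * H2 + N * (1\<^sub>m t - Q ^\<^sub>m n) * H1 * N * R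
    - (A_mat Q (H1 * N) (Suc n) * R - Q ^\<^sub>m n * (H1 * N) * R)"
proof -
  let ?F = "\<lambda>i. Q ^\<^sub>m i * (H1 * N) * Q ^\<^sub>m (n - i)"
  note Qk = pow_carrier_mat[OF Q] and HN = mult_carrier_mat[OF H1 N(2)]
  have F: "?F i \<in> carrier_mat t t" "?F i * R \<in> carrier_mat t a" for i
    using mult_carrier_mat[OF mult_carrier_mat[OF Qk HN] Qk] mult_carrier_mat[OF _ R] by blast+
  have "A_mat Q (H1 * N) (Suc n) * R = mat_sum t a (\<lambda>i. ?F i * R) {..<Suc n}"
    using Q by (simp add: A_mat_def mat_sum_mult_right[OF F(1) R])
  also have "\<dots> = mat_sum t a (\<lambda>i. ?F i * R) {..<n} + ?F n * R"
    by (intro mat_sum_lessThan_Suc F(2))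
  also have "?F n = Q ^\<^sub>m n * (H1 * N)"
    using Q right_mult_one_mat[OF mult_carrier_mat[OF Qk HN]] by simp
  finally have "A_mat Q (H1 * N) (Suc n) * R - Q ^\<^sub>m n * (H1 * N) * R = mat_sum t a (\<lambda>i. ?F i * R) {..<n}"
    using mult_carrier_mat[OF mult_carrier_mat[OF Qk HN] R] by (simp add: add_diff_cancel_right_mat[of _ t a])
  moreover have "Q ^\<^sub>m i * (H1 * N) = Q ^\<^sub>m i * H1 * N" for i
    using assoc_mult_mat[OF Qk H1 N(2)] by simp
  ultimately show ?thesis
    using Q R by (simp add: B_mat_def Let_def N(1))
qed

theorem theorem1:
  fixes t a :: nat
    and P Q R \<Theta> \<Theta>1 \<Theta>2 H1 H2 :: "real mat"
    and M :: "nat \<Rightarrow> 'w measure"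
    and S :: "nat \<Rightarrow> 'w \<Rightarrow> nat"
  assumes "Q \<in> carrier_mat t t" and "R \<in> carrier_mat t a"
    and "P = four_block_mat Q R (0\<^sub>m a t) (1\<^sub>m a)"
    and "transient_states P = {..<t}" and "absorbing_states P = {t..<t + a}"
    and "absorbing_chain P"
    and "\<And>i. i < t + a \<Longrightarrow> markov_chain (M i) S P"
    and "\<And>i. i < t + a \<Longrightarrow> 0 < \<P>(\<omega> in M i. S 0 \<omega> = i)"
    and "\<Theta>1 \<in> carrier_mat t t" and "\<Theta>2 \<in> carrier_mat t a"
    and "\<Theta> = four_block_mat \<Theta>1 \<Theta>2 (0\<^sub>m a t) (0\<^sub>m a a)"
    and "H1 \<in> carrier_mat t t" and "H2 \<in> carrier_mat t a"
    and "\<Theta> \<odot> P = four_block_mat H1 H2 (0\<^sub>m a t) (0\<^sub>m a a)"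
  shows "\<exists>A_inf B_inf R_inf.
      mat_tendsto (A_mat Q H1) A_inf \<and>
      mat_tendsto (B_mat Q R H1 H2) B_inf \<and>
      mat_tendsto (R_hat M S \<Theta>) R_inf \<and>
      A_inf = 0\<^sub>m t t \<and>
      R_inf = four_block_mat (0\<^sub>m t t) B_inf (0\<^sub>m a t) (0\<^sub>m a a) \<and>
      B_inf = fundamental_mat Q * (H2 + H1 * fundamental_mat Q * R)"
proof -
  note Q = assms(1) and R = assms(2) and H1 = assms(12) and H2 = assms(13)
  \<comment> \<open>Stochasticity of \<open>P\<close> comes only from the chain hypothesis at some
    state; the absorbing state \<open>t\<close> is one.\<close>
  have "0 < a" using assms(5,6) by (cases a) (auto simp: absorbing_chain_def)
  then have "stochastic_mat P" using assms(7)[of t] by (simp add: markov_chain_def)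
  then obtain N where N: "N \<in> carrier_mat t t" and sums: "mat_sums (\<lambda>n. Q ^\<^sub>m n) N"
    and nonneg: "\<And>n i j. i < t \<Longrightarrow> j < t \<Longrightarrow> 0 \<le> (Q ^\<^sub>m n) $$ (i, j)"
    using absorbing_chain_mat_sums_pow[OF assms(1-6)] by blast
  have fund: "fundamental_mat Q = N"
    by (rule fundamental_mat_eq_Neumann_series[OF Q N sums])
  have \<Theta>: "\<Theta> \<in> carrier_mat (t + a) (t + a)" using assms(9-11) by auto
  define B where "B = N * (H2 + H1 * N * R)"
  have NH: "N * H2 \<in> carrier_mat t a" "N * H1 \<in> carrier_mat t t" "N * H1 * N \<in> carrier_mat t t"
    "H1 * N \<in> carrier_mat t t" "H1 * N * R \<in> carrier_mat t a" "N * H1 * N * R \<in> carrier_mat t a"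
    using N H1 H2 R by auto
  have B: "B \<in> carrier_mat t a" using N H2 NH by (auto simp: B_def)
  have B_eq: "B = N * H2 + N * H1 * N * R"
    using mult_add_distrib_mat[OF N H2 NH(5)] assoc_mult_mat[OF N NH(4) R] assoc_mult_mat[OF N H1 N]
    by (simp add: B_def)
  have A_sums: "mat_sums (A_mat Q C) (N * C * N)" if "C \<in> carrier_mat t t" for C
    by (rule mat_sums_A_mat[OF Q that N sums nonneg])
  have A_lim: "mat_tendsto (A_mat Q C) (0\<^sub>m t t)" if "C \<in> carrier_mat t t" for C
    by (rule mat_sums_imp_tendsto_zero[OF A_sums[OF that]]) (use N that in auto)
  have Q_lim: "mat_tendsto (\<lambda>n. Q ^\<^sub>m n) (0\<^sub>m t t)"
    by (rule mat_sums_imp_tendsto_zero[OF sums N])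
  then have Q_lim_Suc: "mat_tendsto (\<lambda>n. Q ^\<^sub>m Suc n) (0\<^sub>m t t)"
    using Q by (subst mat_tendsto_Suc_iff) auto

  have "mat_tendsto (\<lambda>n. B_mat Q R H1 H2 (Suc n))
      (N * (1\<^sub>m t - 0\<^sub>m t t) * H2 + N * (1\<^sub>m t - 0\<^sub>m t t) * H1 * N * R
       - (0\<^sub>m t t * R - 0\<^sub>m t t * (H1 * N) * R))"
    unfolding B_mat_Suc[OF Q R H1 fund N]
    by (intro mat_tendsto_diff mat_tendsto_add mat_tendsto_mult mat_tendsto_const Q_lim Q_lim_Suc
        iffD2[OF mat_tendsto_Suc_iff] A_lim) (use Q R H1 H2 N in \<open>auto simp: A_mat_def\<close>)
  moreover have "1\<^sub>m t - 0\<^sub>m t t = (1\<^sub>m t :: real mat)" by (rule eq_matI) auto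
  moreover have "0\<^sub>m t t * R - 0\<^sub>m t t * (H1 * N) * R = 0\<^sub>m t a"
    unfolding left_mult_zero_mat[OF NH(4)] left_mult_zero_mat[OF R] by (rule eq_matI) auto
  moreover have "B - 0\<^sub>m t a = B" using B by (intro eq_matI) auto
  ultimately have "mat_tendsto (\<lambda>n. B_mat Q R H1 H2 (Suc n)) B"
    using N by (simp add: B_eq)
  \<comment> \<open>Only the dimensions at index 0 matter for undoing the shift.\<close>
  moreover have "B_mat Q R H1 H2 0 \<in> carrier_mat t a"
    using Q R by (auto simp: B_mat_def Let_def)
  ultimately have B_lim: "mat_tendsto (B_mat Q R H1 H2) B"
    using B mat_tendsto_Suc_iff[of "B_mat Q R H1 H2" B] by auto

  \<comment> \<open>The absorbing block of \<open>R_hat\<close> is not identified with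
    \<open>B_mat\<close> at finite \<open>n\<close>; the two sequences are only shown to have the
    same limit \<open>B\<close>.\<close>
  have "mat_sums (\<lambda>k. A_mat Q H1 k * R + Q ^\<^sub>m k * H2) (N * H1 * N * R + N * H2)"
    by (intro mat_sums_add mat_sums_mult_right A_sums sums H1) (use N R H1 H2 in auto)
  then have "mat_sums (\<lambda>k. A_mat Q H1 k * R + Q ^\<^sub>m k * H2) B"
    using comm_add_mat[OF NH(1,6)] by (simp add: B_eq)
  from mat_sums_imp_tendsto_partial_sums[OF this B]
  have "mat_tendsto (\<lambda>n. four_block_mat (A_mat Q H1 n)
      (mat_sum t a (\<lambda>k. A_mat Q H1 k * R + Q ^\<^sub>m k * H2) {..<n}) (0\<^sub>m a t) (0\<^sub>m a a))
      (four_block_mat (0\<^sub>m t t) B (0\<^sub>m a t) (0\<^sub>m a a))"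
    by (intro mat_tendsto_four_block[OF A_lim[OF H1] _ mat_tendsto_const mat_tendsto_const
        zero_carrier_mat B zero_carrier_mat zero_carrier_mat])
  moreover have "R_hat M S \<Theta> = (\<lambda>n. four_block_mat (A_mat Q H1 n)
      (mat_sum t a (\<lambda>k. A_mat Q H1 k * R + Q ^\<^sub>m k * H2) {..<n}) (0\<^sub>m a t) (0\<^sub>m a a))"
    by (intro ext R_hat_blocks[OF assms(1-3,7,8) \<Theta> H1 H2 assms(14)])
  ultimately have "mat_tendsto (R_hat M S \<Theta>) (four_block_mat (0\<^sub>m t t) B (0\<^sub>m a t) (0\<^sub>m a a))"
    by simp
  with A_lim[OF H1] B_lim show ?thesis
    unfolding fund B_def by blast
qed

end
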